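(* Let $D$ be a skeletal directed acyclic graph. The two maps $\rho_\vee$ and $I_\vee$ are inverse bijections between the join irreducibles of $\mathcal{AR}_D$ and the ropes of $D$. Likewise, the two maps $\rho_\wedge$ and $I_\wedge$ are inverse bijections between the meet irreducibles of $\mathcal{AR}_D$ and the ropes of $D$.
   Context: All directed graphs are finite and simple. A reorientation of a directed acyclic graph $D=(V,A)$ is a directed graph with the same underlying undirected graph, encoded by the set of arcs of $D$ that it reverses. $\mathcal{AR}_D$ is the poset of acyclic reorientations of $D$ ordered by inclusion of sets of reversed arcs. The transitive reduction of a directed acyclic graph is obtained by deleting all arcs whose endpoints are connected by a directed path of length at least $2$. A directed graph is a forest if its underlying undirected graph has no cycle. $D$ is vertebrate if the transitive reduction of every induced subgraph of $D$ is a forest; filled if for any directed path $\pi$ in $D$ whose endpoints are joined by an arc of $D$, all arcs joining any two vertices of $\pi$ belong to $D$; skeletal if vertebrate and filled. When $D$ is skeletal, $\mathcal{AR}_D$ is a lattice. An element of a lattice is join (resp. meet) irreducible if it covers (resp. is covered by) a unique element; $E\in\mathcal{AR}_D$ is join (resp. meet) irreducible if and only if exactly one arc of its transitive reduction is reversed (resp. not reversed) with respect to $D$. The transitive support of an arc $(u,v)$ of $D$ is the set of vertices appearing along directed paths in $D$ from $u$ to $v$. A rope of $D$ is a quadruple $(u,v,\nabla,\Delta)$ where $(u,v)\in A$ and $\nabla\sqcup\Delta$ is a partition of the transitive support of $(u,v)$ minus $\{u,v\}$. For an acyclic reorientation $E$ of $D$ and an arc $(u,v)$ of $D$, let $\nabla_{u,v}^E=\{w\in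 V : (u,w)\in D\setminus E,\ (w,v)\in D\cap E\}$, $\Delta_{u,v}^E=\{w\in V : (u,w)\in D\cap E,\ (w,v)\in D\setminus E\}$ (membership refers to arcs), and $\rho_{u,v}^E=(u,v,\nabla_{u,v}^E,\Delta_{u,v}^E)$. For a join (resp. meet) irreducible $I$ of $\mathcal{AR}_D$, let $\rho_\vee(I)$ (resp. $\rho_\wedge(I)$) be $\rho_{u,v}^I$ where $(u,v)$ is the only arc of $D$ that is reversed (resp. not reversed) in the transitive reduction of $I$. For a rope $\rho=(u,v,\nabla,\Delta)$, let $I_\vee(\rho)$ be the reorientation of $D$ where an arc $(w,w')$ of $D$ is reversed if and only if $w\in\Delta\cup\{u\}$ and $w'\in\nabla\cup\{v\}$; let $I_\wedge(\rho)$ be the reorientation of $D$ where an arc $(w,w')$ of $D$ is not reversed if and only if $w\in\nabla\cup\{u\}$ and $w'\in\Delta\cup\{v\}$. *)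

theory Defs
  imports "Graph_Theory.Graph_Theory"
begin

text \<open>
  Simple directed graphs are pairs of a vertex set and an arc relation. The constant
  \<^const>\<open>mk_symmetric\<close> serves as the underlying undirected graph; an edge of the latter is
  a pair of opposite arcs.
\<close>

definition reorient :: "'a pair_pre_digraph \<Rightarrow> 'a rel \<Rightarrow> 'a pair_pre_digraph" where
  "reorient D R = D\<lparr>parcs := (parcs D - R) \<union> R\<inverse>\<rparr>"

definition reorientation :: "'a pair_pre_digraph \<Rightarrow> 'a pair_pre_digraph \<Rightarrow> bool" where
  "reorientation D E \<longleftrightarrow>
     mk_symmetric (with_proj E) = mk_symmetric (with_proj D) \<and> asym (parcs E)"

definition reversed_arcs :: "'a pair_pre_digraph \<Rightarrow> 'a pair_pre_digraph \<Rightarrow> 'a rel" where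
  "reversed_arcs D E = {(u, v) \<in> parcs D. (v, u) \<in> parcs E}"

definition acyclic_reorientations :: "'a pair_pre_digraph \<Rightarrow> 'a pair_pre_digraph set" where
  "acyclic_reorientations D = {E. reorientation D E \<and> acyclic (parcs E)}"

definition AR_less :: "'a pair_pre_digraph \<Rightarrow> 'a pair_pre_digraph \<Rightarrow> 'a pair_pre_digraph \<Rightarrow> bool" where
  "AR_less D E F \<longleftrightarrow> reversed_arcs D E \<subset> reversed_arcs D F"

text \<open>\<open>AR_covers D F E\<close> means that \<open>F\<close> covers \<open>E\<close>.\<close>

definition AR_covers :: "'a pair_pre_digraph \<Rightarrow> 'a pair_pre_digraph \<Rightarrow> 'a pair_pre_digraph \<Rightarrow> bool" where
  "AR_covers D F E \<longleftrightarrow>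
     E \<in> acyclic_reorientations D \<and> F \<in> acyclic_reorientations D \<and> AR_less D E F \<and>
     \<not> (\<exists>G \<in> acyclic_reorientations D. AR_less D E G \<and> AR_less D G F)"

definition join_irreducibles :: "'a pair_pre_digraph \<Rightarrow> 'a pair_pre_digraph set" where
  "join_irreducibles D = {I \<in> acyclic_reorientations D. \<exists>!E. AR_covers D I E}"

definition meet_irreducibles :: "'a pair_pre_digraph \<Rightarrow> 'a pair_pre_digraph set" where
  "meet_irreducibles D = {I \<in> acyclic_reorientations D. \<exists>!F. AR_covers D F I}"

definition transitive_reduction :: "('a, 'b) pre_digraph \<Rightarrow> ('a, 'b) pre_digraph" where
  "transitive_reduction G =
     G\<lparr>arcs := {e \<in> arcs G. \<not> (\<exists>p. pre_digraph.apath G (tail G e) p (head G e) \<and> 2 \<le> length p)}\<rparr>"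

text \<open>
  The library's \<^const>\<open>forest\<close> only excludes directed cycles. Here cycles of the underlying
  undirected graph are excluded; the length bound discards the closed walks \<open>a, b, a\<close>
  that traverse a single edge back and forth.
\<close>

definition undirected_forest :: "('a, 'b) pre_digraph \<Rightarrow> bool" where
  "undirected_forest G \<longleftrightarrow>
     \<not> (\<exists>p. pre_digraph.cycle (with_proj (mk_symmetric G)) p \<and> 3 \<le> length p)"

definition vertebrate :: "'a pair_pre_digraph \<Rightarrow> bool" where
  "vertebrate D \<longleftrightarrow>
     (\<forall>S \<subseteq> pverts D. undirected_forest (transitive_reduction (induce_subgraph (with_proj D) S)))"

definition filled :: "'a pair_pre_digraph \<Rightarrow> bool" where
  "filled D \<longleftrightarrow>
     (\<forall>u p v. pre_digraph.apath (with_proj D) u p v \<and> (u, v) \<in> parcs (mk_symmetric (with_proj D)) \<longrightarrow>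
        (\<forall>x \<in> set (pawalk_verts u p). \<forall>y \<in> set (pawalk_verts u p).
           x \<noteq> y \<longrightarrow> (x, y) \<in> parcs (mk_symmetric (with_proj D))))"

definition skeletal :: "'a pair_pre_digraph \<Rightarrow> bool" where
  "skeletal D \<longleftrightarrow> vertebrate D \<and> filled D"

definition transitive_support :: "'a pair_pre_digraph \<Rightarrow> 'a \<Rightarrow> 'a \<Rightarrow> 'a set" where
  "transitive_support D u v =
     {w. \<exists>p. pre_digraph.apath (with_proj D) u p v \<and> w \<in> set (pawalk_verts u p)}"

text \<open>In a rope \<open>(u, v, N, T)\<close>, \<open>N\<close> stands for \<open>\<nabla>\<close> and \<open>T\<close> for \<open>\<Delta>\<close>; either may be empty.\<close>

type_synonym 'a rope = "'a \<times> 'a \<times> 'a set \<times> 'a set"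

definition ropes :: "'a pair_pre_digraph \<Rightarrow> 'a rope set" where
  "ropes D = {(u, v, N, T). (u, v) \<in> parcs D \<and> N \<inter> T = {} \<and> N \<union> T = transitive_support D u v - {u, v}}"

text \<open>
  Below \<open>E\<close> is treated as a directed graph, so \<open>parcs D - parcs E\<close> consists of the
  arcs of \<open>D\<close> that \<open>E\<close> reverses.
\<close>

definition rope_of :: "'a pair_pre_digraph \<Rightarrow> 'a pair_pre_digraph \<Rightarrow> 'a \<times> 'a \<Rightarrow> 'a rope" where
  "rope_of D E = (\<lambda>(u, v).
     (u, v,
      {w \<in> pverts D. (u, w) \<in> parcs D - parcs E \<and> (w, v) \<in> parcs D \<inter> parcs E},
      {w \<in> pverts D. (u, w) \<in> parcs D \<inter> parcs E \<and> (w, v) \<in> parcs D - parcs E}))"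

definition rho_join :: "'a pair_pre_digraph \<Rightarrow> 'a pair_pre_digraph \<Rightarrow> 'a rope" where
  "rho_join D I = rope_of D I
     (THE a. a \<in> parcs D \<and> (snd a, fst a) \<in> arcs (transitive_reduction (with_proj I)))"

definition rho_meet :: "'a pair_pre_digraph \<Rightarrow> 'a pair_pre_digraph \<Rightarrow> 'a rope" where
  "rho_meet D I = rope_of D I
     (THE a. a \<in> parcs D \<and> a \<in> arcs (transitive_reduction (with_proj I)))"

definition I_join :: "'a pair_pre_digraph \<Rightarrow> 'a rope \<Rightarrow> 'a pair_pre_digraph" where
  "I_join D = (\<lambda>(u, v, N, T).
     reorient D {(w, w') \<in> parcs D. w \<in> T \<union> {u} \<and> w' \<in> N \<union> {v}})"

definition I_meet :: "'a pair_pre_digraph \<Rightarrow> 'a rope \<Rightarrow> 'a pair_pre_digraph" where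
  "I_meet D = (\<lambda>(u, v, N, T).
     reorient D {(w, w') \<in> parcs D. \<not> (w \<in> N \<union> {u} \<and> w' \<in> T \<union> {v})})"

end

theory Submission
  imports Defs
begin

text \<open>
  Two acyclic reorientations form a cover exactly when they differ by flipping an arc of the
  transitive reduction, so a join irreducible \<open>I\<close> has a unique reversed arc \<open>v \<rightarrow> u\<close> in its
  transitive reduction. An arc \<open>(w, w')\<close> of \<open>D\<close> is then reversed in \<open>I\<close> iff the path of the
  transitive reduction of \<open>I\<close> from \<open>w'\<close> to \<open>w\<close> runs through \<open>v \<rightarrow> u\<close>; filledness puts
  \<open>w, w'\<close> on the transitive support of \<open>(u, v)\<close>, and \<open>I\<close> is recovered from its rope.
  Conversely, for a rope \<open>(u, v, \<nabla>, \<Delta>)\<close> every path of \<open>D\<close> from \<open>\<Delta> \<union> {u}\<close> to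
  \<open>\<nabla> \<union> {v}\<close> stays in the transitive support and hence contains a reversed arc. So a path
  of \<open>I\<^sub>\<or>\<close> uses at most one reversed arc, which yields acyclicity and shows that \<open>v \<rightarrow> u\<close> is
  the only reversed arc of the transitive reduction. Reversing all arcs of a reorientation
  exchanges join and meet irreducibles as well as \<open>\<nabla>\<close> and \<open>\<Delta>\<close>, which gives the meet half.
\<close>

section \<open>Transitive reductions (\<open>cover_rel\<close>) and acyclic orientations as plain
  relations\<close>

definition cover_rel :: "'a rel \<Rightarrow> 'a rel" where
  "cover_rel E = E - E O E\<^sup>+"

text \<open>Acyclic reorientations with the vertex set left out; the equation compares underlying
  undirected graphs.\<close>

definition orientation :: "'a rel \<Rightarrow> 'a rel \<Rightarrow> bool" where
  "orientation A E \<longleftrightarrow> E \<union> E\<inverse> = A \<union> A\<inverse> \<and> acyclic E"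

text \<open>For acyclic \<open>A\<close> this is the transitive support, with directed paths
  replaced by reachability.\<close>

definition between :: "'a rel \<Rightarrow> 'a \<Rightarrow> 'a \<Rightarrow> 'a set" where
  "between A u v = {w. (u, w) \<in> A\<^sup>* \<and> (w, v) \<in> A\<^sup>*}"

lemma orientation_finite: "orientation A E \<Longrightarrow> finite A \<Longrightarrow> finite E"
  unfolding orientation_def using finite_Un[of E "E\<inverse>"] by simp

lemma acyclic_antisym: "acyclic E \<Longrightarrow> (x, y) \<in> E\<^sup>+ \<Longrightarrow> (y, x) \<in> E\<^sup>* \<Longrightarrow> False"
  by (auto simp: acyclic_def dest: trancl_rtrancl_trancl)

lemma cover_rel_subset: "cover_rel E \<subseteq> E"
  by (auto simp: cover_rel_def)

lemma cover_rel_converse: "cover_rel (E\<inverse>) = (cover_rel E)\<inverse>"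
proof -
  have "E O (E\<^sup>* O E) = (E O E\<^sup>*) O E" by (simp only: O_assoc)
  then have "E O E\<^sup>+ = E\<^sup>+ O E" by (simp only: trancl_unfold_left[symmetric] trancl_unfold_right[symmetric])
  then have "E\<inverse> O (E\<inverse>)\<^sup>+ = (E O E\<^sup>+)\<inverse>" by (simp add: trancl_converse converse_relcomp)
  then show ?thesis unfolding cover_rel_def by blast
qed

text \<open>A bypassed arc splits at an intermediate vertex, and each half has fewer vertices
  strictly between its ends.\<close>

lemma trancl_cover_rel:
  assumes "finite E" "acyclic E"
  shows "(cover_rel E)\<^sup>+ = E\<^sup>+"
proof
  show "(cover_rel E)\<^sup>+ \<subseteq> E\<^sup>+" by (intro trancl_mono_subset cover_rel_subset)
  define I where "I a b = {c. (a, c) \<in> E\<^sup>+ \<and> (c, b) \<in> E\<^sup>+}" for a b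
  have fin: "finite (I a b)" for a b
  proof (rule finite_subset)
    show "I a b \<subseteq> Range (E\<^sup>+)" unfolding I_def by blast
    show "finite (Range (E\<^sup>+))" using assms(1) by (simp add: finite_Range)
  qed
  have "(a, b) \<in> E\<^sup>+ \<Longrightarrow> (a, b) \<in> (cover_rel E)\<^sup>+" for a b
  proof (induction "card (I a b)" arbitrary: a b rule: less_induct)
    case less
    show ?case
    proof (cases "\<exists>c. (a, c) \<in> E\<^sup>+ \<and> (c, b) \<in> E\<^sup>+")
      case True
      then obtain c where c: "(a, c) \<in> E\<^sup>+" "(c, b) \<in> E\<^sup>+" by blast
      have irr: "(c, c) \<notin> E\<^sup>+" using assms(2) by (simp add: acyclic_def)
      \<comment> \<open>By acyclicity \<open>c\<close> is not strictly between itself and either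
        end, so both inclusions below are proper.\<close>
      have cI: "c \<in> I a b" "c \<notin> I a c" "c \<notin> I c b" using c irr by (simp_all add: I_def)
      have "I a c \<subseteq> I a b" "I c b \<subseteq> I a b"
        unfolding I_def using trancl_trans[OF _ c(2)] trancl_trans[OF c(1)] by blast+
      then have "I a c \<subset> I a b" "I c b \<subset> I a b" using cI by blast+
      then have "card (I a c) < card (I a b)" "card (I c b) < card (I a b)"
        by (simp_all add: psubset_card_mono[OF fin])
      then have "(a, c) \<in> (cover_rel E)\<^sup>+" "(c, b) \<in> (cover_rel E)\<^sup>+"
        using less.hyps c by simp_all
      then show ?thesis by (rule trancl_trans)
    next
      case False
      then have "(a, b) \<in> E" using less.prems by (meson r_into_trancl' tranclE)
      with False have "(a, b) \<in> cover_rel E" by (auto simp: cover_rel_def)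
      then show ?thesis by blast
    qed
  qed
  then show "E\<^sup>+ \<subseteq> (cover_rel E)\<^sup>+" by auto
qed

text \<open>A new cycle would need a path from \<open>a\<close> to \<open>b\<close> avoiding the arc
  itself; such a path bypasses the arc, which \<open>cover_rel\<close> forbids.\<close>

lemma acyclic_flip:
  assumes "acyclic E" "(a, b) \<in> cover_rel E"
  shows "acyclic (insert (b, a) (E - {(a, b)}))"
proof -
  have ab: "(a, b) \<in> E" "(a, b) \<notin> E O E\<^sup>+" using assms(2) by (auto simp: cover_rel_def)
  have "a \<noteq> b" using ab assms(1) by (auto simp: acyclic_def)
  have "(a, b) \<notin> (E - {(a, b)})\<^sup>*"
  proof
    assume "(a, b) \<in> (E - {(a, b)})\<^sup>*"
    then obtain c where c: "(a, c) \<in> E - {(a, b)}" "(c, b) \<in> (E - {(a, b)})\<^sup>*"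
      using \<open>a \<noteq> b\<close> by (meson converse_rtranclE)
    then have "(c, b) \<in> E\<^sup>*" by (meson Diff_subset in_mono rtrancl_mono)
    with c ab(2) show False by (auto simp: rtrancl_eq_or_trancl)
  qed
  moreover have "acyclic (E - {(a, b)})" using assms(1) by (meson Diff_subset acyclic_subset)
  ultimately show ?thesis by (simp add: acyclic_insert)
qed

text \<open>\<open>E\<close> has a path along every arc of \<open>F\<close>, so an edge oriented
  differently in the two would close a cycle in \<open>E\<close>.\<close>

lemma orientation_eqI:
  assumes "finite F" "orientation A E" "orientation A F" "cover_rel F \<subseteq> E"
  shows "E = F"
proof -
  have FE: "F\<^sup>+ \<subseteq> E\<^sup>+"
    using trancl_mono_subset[OF assms(4)] trancl_cover_rel[of F] assms(1,3) by (simp add: orientation_def)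
  have "E \<subseteq> F"
  proof
    fix e assume "e \<in> E"
    moreover obtain a b where e: "e = (a, b)" by fastforce
    ultimately have "(a, b) \<in> F \<or> (b, a) \<in> F" using assms(2,3) by (auto simp: orientation_def)
    moreover have "(b, a) \<notin> F"
      using FE \<open>e \<in> E\<close> e assms(2) by (auto simp: orientation_def dest: acyclic_antisym)
    ultimately show "e \<in> F" using e by simp
  qed
  moreover have "F \<subseteq> E"
  proof
    fix e assume "e \<in> F"
    moreover obtain a b where e: "e = (a, b)" by fastforce
    ultimately have "(a, b) \<in> E \<or> (b, a) \<in> E" using assms(2,3) by (auto simp: orientation_def)
    moreover have "(b, a) \<notin> E"
      using FE \<open>e \<in> F\<close> e assms(2) by (auto simp: orientation_def dest: acyclic_antisym)
    ultimately show "e \<in> E" using e by simp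
  qed
  ultimately show ?thesis by blast
qed

section \<open>Reversed arcs and descents over a fixed acyclic relation\<close>

locale acyclic_rel =
  fixes A :: "'a rel"
  assumes fin: "finite A" and acyc: "acyclic A"
begin

definition nabla :: "'a rel \<Rightarrow> 'a \<Rightarrow> 'a \<Rightarrow> 'a set" where
  "nabla E u v = {w. (u, w) \<in> A - E \<and> (w, v) \<in> A \<inter> E}"

definition delta :: "'a rel \<Rightarrow> 'a \<Rightarrow> 'a \<Rightarrow> 'a set" where
  "delta E u v = {w. (u, w) \<in> A \<inter> E \<and> (w, v) \<in> A - E}"

text \<open>The arcs are those of \<open>A\<close>; it is their converses that lie in the transitive reduction of \<open>E\<close>.\<close>

definition descents :: "'a rel \<Rightarrow> 'a rel" where
  "descents E = A \<inter> (cover_rel E)\<inverse>"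

text \<open>The arcs that \<open>I_join\<close> reverses for the rope
  \<open>(u, v, N, T)\<close>.\<close>

definition flips :: "'a \<Rightarrow> 'a \<Rightarrow> 'a set \<Rightarrow> 'a set \<Rightarrow> 'a rel" where
  "flips u v N T = {(w, w') \<in> A. w \<in> T \<union> {u} \<and> w' \<in> N \<union> {v}}"

lemma not_both: "(x, y) \<in> A \<Longrightarrow> (y, x) \<notin> A"
  using acyclic_antisym[OF acyc, of x y] by blast

lemma orientation_iff:
  assumes "orientation A E"
  shows "(x, y) \<in> A \<Longrightarrow> (y, x) \<in> E \<longleftrightarrow> (x, y) \<notin> E"
  using assms acyclic_antisym[of E x y] unfolding orientation_def by blast

lemma eq_if_reversed_eq:
  assumes "orientation A E" "orientation A F" "A \<inter> E\<inverse> = A \<inter> F\<inverse>"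
  shows "E = F"
proof -
  have "E = (A - A \<inter> E\<inverse>) \<union> (A \<inter> E\<inverse>)\<inverse>" if "orientation A E" for E
    using that orientation_iff[OF that] unfolding orientation_def by blast
  from this[OF assms(1)] this[OF assms(2)] assms(3) show ?thesis by simp
qed

lemma orientation_flip:
  assumes "orientation A F" "(u, v) \<in> descents F"
  shows "orientation A (insert (u, v) (F - {(v, u)}))"
    and "A \<inter> (insert (u, v) (F - {(v, u)}))\<inverse> = A \<inter> F\<inverse> - {(u, v)}"
proof -
  have uv: "(u, v) \<in> A" "(v, u) \<in> cover_rel F" "(v, u) \<in> F"
    using assms(2) cover_rel_subset by (auto simp: descents_def)
  show "orientation A (insert (u, v) (F - {(v, u)}))"
    using assms(1) acyclic_flip[OF _ uv(2)] uv(3) unfolding orientation_def by blast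
  show "A \<inter> (insert (u, v) (F - {(v, u)}))\<inverse> = A \<inter> F\<inverse> - {(u, v)}"
    using not_both[OF uv(1)] by auto
qed

text \<open>Otherwise \<open>E\<close> contains the whole reduction of \<open>F\<close>, since arcs
  unreversed in \<open>F\<close> are unreversed in \<open>E\<close>, and
  \<open>orientation_eqI\<close> applies. The arc found can be flipped in \<open>F\<close> without
  dropping below \<open>E\<close>.\<close>

lemma ex_descent:
  assumes E: "orientation A E" and F: "orientation A F" and less: "A \<inter> E\<inverse> \<subset> A \<inter> F\<inverse>"
  obtains u v where "(u, v) \<in> descents F" "(u, v) \<notin> A \<inter> E\<inverse>"
proof -
  have "\<exists>a \<in> descents F. a \<notin> A \<inter> E\<inverse>"
  proof (rule ccontr)
    assume *: "\<not> (\<exists>a \<in> descents F. a \<notin> A \<inter> E\<inverse>)"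
    have "(a, b) \<in> E" if ab: "(a, b) \<in> cover_rel F" for a b
    proof (cases "(b, a) \<in> A")
      case True
      then show ?thesis using * ab by (auto simp: descents_def)
    next
      case False
      have "(a, b) \<in> F" using ab cover_rel_subset by blast
      then have "(a, b) \<in> A" using False F by (auto simp: orientation_def)
      then show ?thesis using \<open>(a, b) \<in> F\<close> less orientation_iff[OF E] orientation_iff[OF F] by blast
    qed
    then have "E = F" by (intro orientation_eqI[OF orientation_finite[OF F fin] E F]) auto
    with less show False by simp
  qed
  then show ?thesis using that by auto
qed

end

section \<open>Unique descents and ropes in a filled relation\<close>

locale filled_rel = acyclic_rel +
  assumes filledL: "(u, v) \<in> A \<Longrightarrow> w \<in> between A u v \<Longrightarrow> w \<noteq> u \<Longrightarrow> (u, w) \<in> A"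
    and filledR: "(u, v) \<in> A \<Longrightarrow> w \<in> between A u v \<Longrightarrow> w \<noteq> v \<Longrightarrow> (w, v) \<in> A"
begin

text \<open>Filledness joins \<open>w\<close> to both ends. Keeping both arcs closes a cycle with
  \<open>v \<rightarrow> u\<close>, reversing both bypasses it; so exactly one is reversed.\<close>

lemma nabla_Un_delta:
  assumes E: "orientation A E" and uv: "(u, v) \<in> descents E"
  shows "nabla E u v \<union> delta E u v = between A u v - {u, v}"
proof
  show "nabla E u v \<union> delta E u v \<subseteq> between A u v - {u, v}"
    using acyc by (auto simp: nabla_def delta_def between_def acyclic_def)
  have uvA: "(u, v) \<in> A" and vu: "(v, u) \<in> E" "(v, u) \<notin> E O E\<^sup>+"
    using uv by (auto simp: descents_def cover_rel_def)
  show "between A u v - {u, v} \<subseteq> nabla E u v \<union> delta E u v"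
  proof
    fix w assume w: "w \<in> between A u v - {u, v}"
    then have A: "(u, w) \<in> A" "(w, v) \<in> A" using filledL filledR uvA by blast+
    have "\<not> ((u, w) \<in> E \<and> (w, v) \<in> E)"
      using vu(1) E acyclic_antisym[of E u v] unfolding orientation_def by (meson r_into_rtrancl r_into_trancl' trancl_into_trancl)
    moreover have "\<not> ((v, w) \<in> E \<and> (w, u) \<in> E)" using vu(2) by blast
    ultimately show "w \<in> nabla E u v \<union> delta E u v"
      using A orientation_iff[OF E] by (auto simp: nabla_def delta_def)
  qed
qed

lemma reversed_iff_flips:
  assumes E: "orientation A E" and desc: "descents E = {(u, v)}"
  shows "A \<inter> E\<inverse> = flips u v (nabla E u v) (delta E u v)"
proof -
  have uv: "(u, v) \<in> A" "(v, u) \<in> E" using desc by (auto simp: descents_def cover_rel_def)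
  have acycE: "acyclic E" using E by (simp add: orientation_def)
  have "(w', w) \<in> E \<longleftrightarrow> w \<in> delta E u v \<union> {u} \<and> w' \<in> nabla E u v \<union> {v}" if A: "(w, w') \<in> A" for w w'
  proof
    assume "w \<in> delta E u v \<union> {u} \<and> w' \<in> nabla E u v \<union> {v}"
    then have "(w', v) \<in> E\<^sup>*" "(u, w) \<in> E\<^sup>*" by (auto simp: delta_def nabla_def)
    with uv(2) have "(w', w) \<in> E\<^sup>+" by (meson rtrancl_into_trancl1 trancl_rtrancl_trancl)
    then have "(w, w') \<notin> E" using acyclic_antisym[OF acycE] by blast
    then show "(w', w) \<in> E" using orientation_iff[OF E A] by blast
  next
    assume w: "(w', w) \<in> E"
    \<comment> \<open>As \<open>(u, v)\<close> is the only descent, every other arc of the reduction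
      is an arc of \<open>A\<close>.\<close>
    have "cover_rel E \<subseteq> insert (v, u) (E \<inter> A)"
      using desc cover_rel_subset[of E] E unfolding descents_def orientation_def by auto
    then have "E\<^sup>+ \<subseteq> (insert (v, u) (E \<inter> A))\<^sup>+"
      using trancl_cover_rel[OF orientation_finite[OF E fin] acycE] trancl_mono_subset by metis
    \<comment> \<open>The path either uses \<open>v \<rightarrow> u\<close> or lies in
      \<open>A\<close>; the latter closes a cycle of \<open>A\<close> with
      \<open>(w, w')\<close>.\<close>
    with w have "(w', w) \<in> (E \<inter> A)\<^sup>+ \<or> (w', v) \<in> (E \<inter> A)\<^sup>* \<and> (u, w) \<in> (E \<inter> A)\<^sup>*"
      by (auto simp: trancl_insert)
    moreover have "(w', w) \<notin> (E \<inter> A)\<^sup>+"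
      using A acyc by (meson Int_lower2 acyclic_antisym in_mono r_into_rtrancl trancl_mono_subset)
    moreover have "(E \<inter> A)\<^sup>* \<subseteq> E\<^sup>*" "(E \<inter> A)\<^sup>* \<subseteq> A\<^sup>*" by (auto intro!: rtrancl_mono)
    ultimately have path: "(w', v) \<in> E\<^sup>*" "(u, w) \<in> E\<^sup>*" "(w', v) \<in> A\<^sup>*" "(u, w) \<in> A\<^sup>*" by auto
    then have btw: "w \<in> between A u v" "w' \<in> between A u v"
      using A by (auto simp: between_def intro: converse_rtrancl_into_rtrancl rtrancl_into_rtrancl)
    have ne: "w \<noteq> v" "w' \<noteq> u"
      using A path(3,4) acyclic_antisym[OF acyc] by blast+
    have "w = u \<or> w \<in> delta E u v \<union> nabla E u v" "w' = v \<or> w' \<in> delta E u v \<union> nabla E u v"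
      using nabla_Un_delta[OF E, of u v] desc btw ne by auto
    \<comment> \<open>On the wrong side, \<open>w\<close> would have an arc to \<open>u\<close> in
      \<open>E\<close> against the path from \<open>u\<close> to \<open>w\<close>; similarly for
      \<open>w'\<close> and \<open>v\<close>.\<close>
    moreover have "w \<notin> nabla E u v" "w' \<notin> delta E u v"
      using path(1,2) acyclic_antisym[OF acycE] orientation_iff[OF E]
      unfolding nabla_def delta_def by blast+
    ultimately show "w \<in> delta E u v \<union> {u} \<and> w' \<in> nabla E u v \<union> {v}" by auto
  qed
  then show ?thesis by (auto simp: flips_def)
qed

section \<open>The orientation \<open>J\<close> built from a rope\<close>

context
  fixes u v N T
  assumes uv: "(u, v) \<in> A" and disj: "N \<inter> T = {}" and union: "N \<union> T = between A u v - {u, v}"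
begin

abbreviation "R \<equiv> flips u v N T"
abbreviation "J \<equiv> (A - R) \<union> R\<inverse>"

lemma uv_ne: "u \<noteq> v" using uv acyc by (auto simp: acyclic_def)

text \<open>Each end of the arc joins one side of the rope; the two blocks are the source and target
  blocks in the definition of \<open>R\<close>.\<close>

lemma split_iff: "w \<in> between A u v \<longleftrightarrow> w \<in> T \<union> {u} \<or> w \<in> N \<union> {v}"
  using union uv by (auto simp: between_def)

lemma split_disj: "w \<in> T \<union> {u} \<Longrightarrow> w \<in> N \<union> {v} \<Longrightarrow> False"
  using union disj uv_ne by auto

text \<open>An unreversed path from the source block that can still reach \<open>v\<close> stays in
  the support, and stepping into the target block would use an arc of \<open>R\<close>.\<close>

lemma no_path:
  assumes "(x, y) \<in> (A - R)\<^sup>*" "x \<in> T \<union> {u}" "y \<in> N \<union> {v}"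
  shows False
proof -
  \<comment> \<open>Reachability of \<open>v\<close> is a premise of the induction; it keeps the
    next vertex in the support.\<close>
  from assms(1) have "(y, v) \<in> A\<^sup>* \<Longrightarrow> y \<in> T \<union> {u}"
  proof (induction rule: rtrancl_induct)
    case base
    show ?case using assms(2) .
  next
    case (step y z)
    then have yT: "y \<in> T \<union> {u}" by (metis DiffD1 converse_rtrancl_into_rtrancl)
    then have "(u, y) \<in> A\<^sup>*" using split_iff[of y] by (auto simp: between_def)
    then have "z \<in> between A u v" using step.hyps(2) step.prems by (auto simp: between_def)
    moreover have "z \<notin> N \<union> {v}" using step.hyps(2) yT by (auto simp: flips_def)
    ultimately show ?case using split_iff by blast
  qed
  moreover have "(y, v) \<in> A\<^sup>*" using assms(3) split_iff[of y] by (auto simp: between_def)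
  ultimately show False using assms(3) split_disj by blast
qed

text \<open>A reversed arc ends in \<open>T \<union> {u}\<close> and the next would start in
  \<open>N \<union> {v}\<close>, after an unreversed stretch that \<open>no_path\<close> forbids. So
  at most one occurs, from \<open>y\<close> to \<open>x\<close>.\<close>

lemma path_cases:
  assumes "(a, b) \<in> J\<^sup>+"
  shows "(a, b) \<in> (A - R)\<^sup>+ \<or>
    (\<exists>y \<in> N \<union> {v}. \<exists>x \<in> T \<union> {u}. (a, y) \<in> (A - R)\<^sup>* \<and> (x, b) \<in> (A - R)\<^sup>*)"
  using assms
proof (induction rule: trancl_induct)
  case (base b)
  then show ?case by (auto simp: flips_def)
next
  case (step b c)
  show ?case
  proof (cases "(b, c) \<in> A - R")
    case True
    then show ?thesis using step.IH by (meson rtrancl.rtrancl_into_rtrancl trancl.trancl_into_trancl)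
  next
    case False
    then have "b \<in> N \<union> {v}" "c \<in> T \<union> {u}" using step.hyps(2) by (auto simp: flips_def)
    then show ?thesis using step.IH no_path by (meson rtrancl.rtrancl_refl trancl_into_rtrancl)
  qed
qed

lemma rtrancl_R: "(a, b) \<in> (A - R)\<^sup>* \<Longrightarrow> (a, b) \<in> A\<^sup>*"
  using rtrancl_mono[of "A - R" A] by blast

lemma trancl_R: "(a, b) \<in> (A - R)\<^sup>+ \<Longrightarrow> (a, b) \<in> A\<^sup>+"
  using trancl_mono_subset[of "A - R" A] by blast

lemma orientation_of_rope: "orientation A J"
proof -
  have "(a, a) \<notin> J\<^sup>+" for a
  proof
    assume "(a, a) \<in> J\<^sup>+"
    from path_cases[OF this] show False
    proof
      assume "(a, a) \<in> (A - R)\<^sup>+"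
      then show False using trancl_R acyc unfolding acyclic_def by blast
    next
      assume "\<exists>y \<in> N \<union> {v}. \<exists>x \<in> T \<union> {u}. (a, y) \<in> (A - R)\<^sup>* \<and> (x, a) \<in> (A - R)\<^sup>*"
      \<comment> \<open>Joined at \<open>a\<close>, the two stretches form an unreversed path from
        \<open>x\<close> to \<open>y\<close>.\<close>
      then show False using no_path rtrancl_trans by metis
    qed
  qed
  then show ?thesis by (auto simp: orientation_def acyclic_def flips_def)
qed

text \<open>For \<open>w\<close> in \<open>N\<close>, filledness supplies both arcs, and only
  \<open>(u, w)\<close> lies in \<open>R\<close>. Conversely a reversed \<open>(u, w)\<close> puts
  \<open>w\<close> in \<open>N \<union> {v}\<close>, and \<open>w = v\<close> would make
  \<open>(w, v)\<close> a loop.\<close>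

lemma nabla_of_rope: "nabla J u v = N"
proof -
  have "w \<in> nabla J u v" if "w \<in> N" for w
  proof -
    have "w \<in> between A u v" "w \<noteq> u" "w \<noteq> v" "w \<notin> T" using that union disj by auto
    then show ?thesis using that filledL[OF uv] filledR[OF uv] not_both
      by (auto simp: nabla_def flips_def)
  qed
  moreover have "w \<in> N" if "w \<in> nabla J u v" for w
    using that acyc by (auto simp: nabla_def flips_def acyclic_def)
  ultimately show ?thesis by blast
qed

lemma delta_of_rope: "delta J u v = T"
proof -
  have "w \<in> delta J u v" if "w \<in> T" for w
  proof -
    have "w \<in> between A u v" "w \<noteq> u" "w \<noteq> v" "w \<notin> N" using that union disj by auto
    then show ?thesis using that filledL[OF uv] filledR[OF uv] not_both
      by (auto simp: delta_def flips_def)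
  qed
  moreover have "w \<in> T" if "w \<in> delta J u v" for w
    using that acyc by (auto simp: delta_def flips_def acyclic_def)
  ultimately show ?thesis by blast
qed

lemma descents_of_rope: "descents J = {(u, v)}"
proof -
  have vuJ: "(v, u) \<in> J" using uv by (auto simp: flips_def)
  have "(v, u) \<notin> J O J\<^sup>+"
  proof
    assume "(v, u) \<in> J O J\<^sup>+"
    then obtain c where c: "(v, c) \<in> J" "(c, u) \<in> J\<^sup>+" by blast
    show False
    proof (cases "(v, c) \<in> A - R")
      case True
      then have vc: "(v, c) \<in> A\<^sup>+" by auto
      \<comment> \<open>An unreversed path to \<open>u\<close> continues along
        \<open>(u, v)\<close>; any other one gives an unreversed path to some \<open>y\<close> in
        the target block, which reaches \<open>v\<close>.\<close>
      have cv: "(c, v) \<in> A\<^sup>*"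
        using path_cases[OF c(2)]
      proof
        assume "(c, u) \<in> (A - R)\<^sup>+"
        then show ?thesis using uv by (meson rtrancl.rtrancl_into_rtrancl trancl_R trancl_into_rtrancl)
      next
        assume "\<exists>y \<in> N \<union> {v}. \<exists>x \<in> T \<union> {u}. (c, y) \<in> (A - R)\<^sup>* \<and> (x, u) \<in> (A - R)\<^sup>*"
        then obtain y where "y \<in> N \<union> {v}" "(c, y) \<in> (A - R)\<^sup>*" by blast
        then show ?thesis using split_iff[of y] rtrancl_R
          by (metis (mono_tags, lifting) between_def mem_Collect_eq rtrancl_trans)
      qed
      show False using acyclic_antisym[OF acyc vc cv] .
    next
      case False
      then have cT: "c \<in> T \<union> {u}" using c(1) by (auto simp: flips_def)
      then have "(u, c) \<in> A\<^sup>*" using split_iff[of c] by (auto simp: between_def)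
      then have "(c, u) \<notin> (A - R)\<^sup>+" using trancl_R acyclic_antisym[OF acyc] by blast
      then show False using path_cases[OF c(2)] no_path cT by blast
    qed
  qed
  then have "(u, v) \<in> descents J" using uv vuJ by (simp add: descents_def cover_rel_def)
  \<comment> \<open>A descent runs from source to target block, and
    \<open>b \<rightarrow> v \<rightarrow> u \<rightarrow> a\<close> in \<open>J\<close> bypasses it
    unless \<open>a = u\<close> and \<open>b = v\<close>.\<close>
  moreover have "a = u \<and> b = v" if "(a, b) \<in> descents J" for a b
  proof -
    have ab: "(a, b) \<in> A" "(b, a) \<in> J" "(b, a) \<notin> J O J\<^sup>+"
      using that by (auto simp: descents_def cover_rel_def)
    then have X: "a \<in> T \<union> {u}" and Y: "b \<in> N \<union> {v}" using not_both by (auto simp: flips_def)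
    have ua: "(u, a) \<in> J" if "a \<noteq> u"
      using filledL[OF uv _ that] X split_disj[of a] split_iff[of a] by (auto simp: flips_def)
    have bv: "(b, v) \<in> J" if "b \<noteq> v"
      using filledR[OF uv _ that] Y split_disj[of b] split_iff[of b] by (auto simp: flips_def)
    have va: "(v, a) \<in> J\<^sup>+" using vuJ ua by (cases "a = u") (auto intro: trancl_into_trancl)
    have "b = v" using bv va ab(3) by blast
    moreover have "a = u" using ua vuJ ab(3) \<open>b = v\<close> by blast
    ultimately show ?thesis by simp
  qed
  ultimately show ?thesis by auto
qed

end

end

section \<open>Directed paths as closures of the arc relation\<close>

lemma (in pair_wf_digraph) apath_iff_awalk:
  assumes "acyclic (parcs G)"
  shows "apath u p v \<longleftrightarrow> awalk u p v"
proof (induction p arbitrary: u)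
  case (Cons e p)
  \<comment> \<open>The tail of the first arc reappearing later on the walk would close a
    cycle.\<close>
  have False if e: "e \<in> parcs G" "awalk (snd e) p v" "fst e \<in> set (pawalk_verts (snd e) p)"
  proof -
    obtain q where "awalk (snd e) q (fst e)" using awalk_decomp[OF e(2,3)] by blast
    then have "awalk (fst e) (e # q) (fst e)" using e(1) by (simp add: awalk_Cons_iff)
    then have "(fst e, fst e) \<in> (parcs G)\<^sup>+" using reachable1_awalkI by simp
    then show False using assms by (simp add: acyclic_def)
  qed
  then show ?case using Cons.IH by (auto simp: apath_Cons_iff awalk_Cons_iff)
qed (simp add: apath_Nil_iff awalk_Nil_iff)

lemma (in pair_wf_digraph) arcs_transitive_reduction:
  assumes "acyclic (parcs G)"
  shows "arcs (transitive_reduction (with_proj G)) = cover_rel (parcs G)"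
proof -
  have "(\<exists>p. awalk a p b \<and> 2 \<le> length p) \<longleftrightarrow> (a, b) \<in> parcs G O (parcs G)\<^sup>+" for a b
  proof
    assume "\<exists>p. awalk a p b \<and> 2 \<le> length p"
    then obtain e f p where "awalk a (e # f # p) b"
      by (metis One_nat_def Suc_1 Suc_le_length_iff)
    then have "e \<in> parcs G" "a = fst e" "awalk (snd e) (f # p) b" by (simp_all add: awalk_Cons_iff)
    then show "(a, b) \<in> parcs G O (parcs G)\<^sup>+"
      using reachable1_awalkI[of "snd e" "f # p" b] by (cases e) auto
  next
    assume "(a, b) \<in> parcs G O (parcs G)\<^sup>+"
    then obtain c p where "(a, c) \<in> parcs G" "awalk c p b" "p \<noteq> []"
      by (auto simp: reachable1_awalk)
    then have "awalk a ((a, c) # p) b \<and> 2 \<le> length ((a, c) # p)"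
      by (cases p) (simp_all add: awalk_Cons_iff)
    then show "\<exists>p. awalk a p b \<and> 2 \<le> length p" by blast
  qed
  then show ?thesis
    by (auto simp: transitive_reduction_def cover_rel_def apath_iff_awalk[OF assms])
qed

text \<open>The reflexive case is the empty walk, which must sit at a vertex.\<close>

lemma (in pair_wf_digraph) awalk_iff_rtrancl:
  assumes "u \<in> pverts G"
  shows "(\<exists>p. awalk u p v) \<longleftrightarrow> (u, v) \<in> (parcs G)\<^sup>*"
proof -
  have "(\<exists>p. awalk u p v) \<longleftrightarrow> awalk u [] v \<or> (\<exists>p. awalk u p v \<and> p \<noteq> [])" by metis
  then show ?thesis using assms by (auto simp: rtrancl_eq_or_trancl reachable1_awalk awalk_Nil_iff)
qed

text \<open>Walks are cut and glued at \<open>w\<close>; acyclicity makes the glued walk a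
  path.\<close>

lemma (in pair_wf_digraph) transitive_support_eq_between:
  assumes "acyclic (parcs G)" "u \<in> pverts G"
  shows "transitive_support G u v = between (parcs G) u v"
proof -
  have "(\<exists>p. awalk u p v \<and> w \<in> set (pawalk_verts u p)) \<longleftrightarrow>
      (\<exists>q. awalk u q w) \<and> (\<exists>r. awalk w r v)" for w
  proof
    assume "\<exists>p. awalk u p v \<and> w \<in> set (pawalk_verts u p)"
    then show "(\<exists>q. awalk u q w) \<and> (\<exists>r. awalk w r v)" using awalk_decomp by blast
  next
    assume "(\<exists>q. awalk u q w) \<and> (\<exists>r. awalk w r v)"
    then obtain q r where qr: "awalk u q w" "awalk w r v" by blast
    then have "w \<in> set (pawalk_verts u (q @ r))"
      using set_awalk_verts_append[OF qr] hd_in_awalk_verts(1)[OF qr(2)] by auto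
    then show "\<exists>p. awalk u p v \<and> w \<in> set (pawalk_verts u p)" using awalk_appendI[OF qr] by blast
  qed
  moreover have "(\<exists>q. awalk u q w) \<and> (\<exists>r. awalk w r v) \<longleftrightarrow>
      (u, w) \<in> (parcs G)\<^sup>* \<and> (w, v) \<in> (parcs G)\<^sup>*" for w
    using awalk_iff_rtrancl[OF assms(2), of w] awalk_iff_rtrancl[of w v] awalk_last_in_verts by blast
  ultimately show ?thesis
    by (simp add: transitive_support_def between_def apath_iff_awalk[OF assms(1)])
qed

section \<open>Acyclic reorientations as orientations of the arc relation\<close>

lemma mk_symmetric_eq:
  "mk_symmetric (with_proj F) = \<lparr>pverts = pverts F, parcs = parcs F \<union> (parcs F)\<inverse>\<rparr>"
  by (auto simp: mk_symmetric_def)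

lemma acyclic_reorientations_iff:
  "E \<in> acyclic_reorientations D \<longleftrightarrow> pverts E = pverts D \<and> orientation (parcs D) (parcs E)"
proof -
  have "mk_symmetric (with_proj E) = mk_symmetric (with_proj D) \<longleftrightarrow>
      pverts E = pverts D \<and> parcs E \<union> (parcs E)\<inverse> = parcs D \<union> (parcs D)\<inverse>"
    by (simp add: mk_symmetric_eq)
  moreover have "acyclic (parcs E) \<Longrightarrow> asym (parcs E)"
    by (meson acyclic_antisym asymI r_into_rtrancl r_into_trancl')
  ultimately show ?thesis
    by (auto simp: acyclic_reorientations_def reorientation_def orientation_def)
qed

lemma acyclic_reorientations_eqI:
  fixes E :: "'a pair_pre_digraph"
  assumes "E \<in> acyclic_reorientations D" "F \<in> acyclic_reorientations D" "parcs E = parcs F"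
  shows "E = F"
  using assms by (simp add: acyclic_reorientations_iff)

lemma reversed_arcs_eq: "reversed_arcs D E = parcs D \<inter> (parcs E)\<inverse>"
  by (auto simp: reversed_arcs_def)

text \<open>The order-reversing involution on acyclic reorientations that reduces the meet half to
  the join half.\<close>

definition opposite :: "'a pair_pre_digraph \<Rightarrow> 'a pair_pre_digraph" where
  "opposite E = E\<lparr>parcs := (parcs E)\<inverse>\<rparr>"

definition swap_rope :: "'a rope \<Rightarrow> 'a rope" where
  "swap_rope = (\<lambda>(u, v, N, T). (u, v, T, N))"

section \<open>Covers and join irreducibles\<close>

locale acyclic_digraph = pair_digraph D for D :: "'a pair_pre_digraph" +
  assumes acyclic_arcs: "acyclic (parcs D)"

sublocale acyclic_digraph \<subseteq> acyclic_rel "parcs D"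
  by unfold_locales (use pair_finite_arcs acyclic_arcs in auto)

context acyclic_digraph
begin

text \<open>For a descent \<open>a\<close> of \<open>F\<close>, \<open>prod.swap a\<close> is its
  reversed copy in \<open>F\<close>; the flip undoes this one reversal.\<close>

abbreviation flip :: "'a pair_pre_digraph \<Rightarrow> 'a \<times> 'a \<Rightarrow> 'a pair_pre_digraph" where
  "flip F a \<equiv> F\<lparr>parcs := insert a (parcs F - {prod.swap a})\<rparr>"

lemma flip_reorientation:
  assumes "F \<in> acyclic_reorientations D" "a \<in> descents (parcs F)"
  shows "flip F a \<in> acyclic_reorientations D"
    and "reversed_arcs D (flip F a) = reversed_arcs D F - {a}"
    and "a \<in> reversed_arcs D F"
proof -
  obtain u v where a: "a = (u, v)" by fastforce
  show "flip F a \<in> acyclic_reorientations D" "reversed_arcs D (flip F a) = reversed_arcs D F - {a}"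
    using orientation_flip[of "parcs F" u v] assms
    by (simp_all add: acyclic_reorientations_iff reversed_arcs_eq a)
  show "a \<in> reversed_arcs D F"
    using assms(2) cover_rel_subset by (auto simp: descents_def reversed_arcs_eq)
qed

text \<open>By \<open>ex_descent\<close>, some flip of \<open>F\<close> still lies above
  \<open>E\<close>, so a cover must equal it. Conversely, reversed sets differing by one arc leave
  no room in between.\<close>

lemma AR_covers_iff:
  "AR_covers D F E \<longleftrightarrow> F \<in> acyclic_reorientations D \<and> (\<exists>a \<in> descents (parcs F). E = flip F a)"
proof
  assume cov: "AR_covers D F E"
  then have E: "E \<in> acyclic_reorientations D" and F: "F \<in> acyclic_reorientations D"
    and less: "reversed_arcs D E \<subset> reversed_arcs D F"
    by (auto simp: AR_covers_def AR_less_def)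
  then obtain u v where uv: "(u, v) \<in> descents (parcs F)" "(u, v) \<notin> reversed_arcs D E"
    using ex_descent[of "parcs E" "parcs F"] by (auto simp: acyclic_reorientations_iff reversed_arcs_eq)
  note G = flip_reorientation[OF F uv(1)]
  have "reversed_arcs D E = reversed_arcs D (flip F (u, v))"
  proof (rule ccontr)
    assume "reversed_arcs D E \<noteq> reversed_arcs D (flip F (u, v))"
    then have "AR_less D E (flip F (u, v))" "AR_less D (flip F (u, v)) F"
      using less uv(2) G(2,3) unfolding AR_less_def by blast+
    with cov G(1) show False unfolding AR_covers_def by blast
  qed
  then have "E = flip F (u, v)"
    using eq_if_reversed_eq[of "parcs E"] E G(1)
    by (intro acyclic_reorientations_eqI[OF E G(1)]) (auto simp: acyclic_reorientations_iff reversed_arcs_eq)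
  with F uv(1) show "F \<in> acyclic_reorientations D \<and> (\<exists>a \<in> descents (parcs F). E = flip F a)" by blast
next
  assume "F \<in> acyclic_reorientations D \<and> (\<exists>a \<in> descents (parcs F). E = flip F a)"
  then obtain a where a: "F \<in> acyclic_reorientations D" "a \<in> descents (parcs F)" "E = flip F a" by blast
  then show "AR_covers D F E"
    using flip_reorientation[OF a(1,2)] unfolding AR_covers_def AR_less_def by blast
qed

text \<open>Each flip removes exactly its own descent from the reversed set, so distinct descents
  give distinct lower covers.\<close>

lemma join_irreducibles_iff:
  "I \<in> join_irreducibles D \<longleftrightarrow>
     I \<in> acyclic_reorientations D \<and> (\<exists>u v. descents (parcs I) = {(u, v)})"
proof -
  have "(\<exists>!E. AR_covers D I E) \<longleftrightarrow> (\<exists>a. descents (parcs I) = {a})"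
    if I: "I \<in> acyclic_reorientations D"
  proof
    assume "\<exists>!E. AR_covers D I E"
    then obtain E where E: "AR_covers D I E" and uniq: "\<And>E'. AR_covers D I E' \<Longrightarrow> E' = E" by blast
    from E obtain a where a: "a \<in> descents (parcs I)" "E = flip I a" by (auto simp: AR_covers_iff)
    have "b = a" if "b \<in> descents (parcs I)" for b
    proof -
      have "flip I b = flip I a" using uniq[of "flip I b"] that I a(2) unfolding AR_covers_iff by blast
      then show ?thesis
        using flip_reorientation(2,3)[OF I that] flip_reorientation(2,3)[OF I a(1)] by auto
    qed
    then show "\<exists>a. descents (parcs I) = {a}" using a(1) by blast
  next
    assume "\<exists>a. descents (parcs I) = {a}"
    then show "\<exists>!E. AR_covers D I E" using I by (auto simp: AR_covers_iff)
  qed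
  then show ?thesis by (auto simp: join_irreducibles_def)
qed

lemma arcs_transitive_reduction_reorientation:
  assumes "I \<in> acyclic_reorientations D"
  shows "arcs (transitive_reduction (with_proj I)) = cover_rel (parcs I)"
proof -
  have I: "pverts I = pverts D" "parcs I \<subseteq> parcs D \<union> (parcs D)\<inverse>" "acyclic (parcs I)"
    using assms by (auto simp: acyclic_reorientations_iff orientation_def)
  have "pair_wf_digraph I"
  proof
    fix e assume "e \<in> parcs I"
    then have "(fst e, snd e) \<in> parcs D \<or> (snd e, fst e) \<in> parcs D" using I(2) by auto
    then show "fst e \<in> pverts I" "snd e \<in> pverts I" using I(1) in_arcsD1 in_arcsD2 by auto
  qed
  then show ?thesis using pair_wf_digraph.arcs_transitive_reduction I(3) by blast
qed

lemma rope_of_eq: "rope_of D E (u, v) = (u, v, nabla (parcs E) u v, delta (parcs E) u v)"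
  by (auto simp: rope_of_def nabla_def delta_def dest: in_arcsD2)

lemma rho_join_eq:
  assumes "I \<in> acyclic_reorientations D" "descents (parcs I) = {(u, v)}"
  shows "rho_join D I = (u, v, nabla (parcs I) u v, delta (parcs I) u v)"
proof -
  \<comment> \<open>Identifies the arc chosen by \<open>THE\<close> in
    \<open>rho_join\<close>.\<close>
  have "a \<in> parcs D \<and> (snd a, fst a) \<in> cover_rel (parcs I) \<longleftrightarrow> a = (u, v)" for a
    using assms(2) unfolding descents_def by (cases a) auto
  then show ?thesis
    by (simp add: rho_join_def arcs_transitive_reduction_reorientation[OF assms(1)] rope_of_eq)
qed

lemma I_join_eq: "I_join D (u, v, N, T) = D\<lparr>parcs := (parcs D - flips u v N T) \<union> (flips u v N T)\<inverse>\<rparr>"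
  by (simp add: I_join_def reorient_def flips_def)

lemma ropes_iff:
  "(u, v, N, T) \<in> ropes D \<longleftrightarrow>
     (u, v) \<in> parcs D \<and> N \<inter> T = {} \<and> N \<union> T = between (parcs D) u v - {u, v}"
  using transitive_support_eq_between[OF acyclic_arcs] in_arcsD1 by (auto simp: ropes_def)

section \<open>Duality between join and meet\<close>

lemma opposite_opposite [simp]: "opposite (opposite E) = E"
  by (simp add: opposite_def)

lemma opposite_reorientation [simp]:
  "opposite E \<in> acyclic_reorientations D \<longleftrightarrow> E \<in> acyclic_reorientations D"
  by (auto simp: acyclic_reorientations_iff opposite_def orientation_def Un_commute)

text \<open>Passing to the opposite complements the reversed set within
  \<open>parcs D\<close>.\<close>

lemma AR_less_opposite:
  assumes "E \<in> acyclic_reorientations D" "F \<in> acyclic_reorientations D"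
  shows "AR_less D (opposite F) (opposite E) \<longleftrightarrow> AR_less D E F"
proof -
  have "reversed_arcs D (opposite E) = parcs D - reversed_arcs D E"
    if "E \<in> acyclic_reorientations D" for E
    using that orientation_iff[of "parcs E"]
    by (auto simp: acyclic_reorientations_iff reversed_arcs_eq opposite_def)
  moreover have "reversed_arcs D E \<subseteq> parcs D" "reversed_arcs D F \<subseteq> parcs D"
    by (auto simp: reversed_arcs_eq)
  moreover have "X - B \<subset> X - A \<longleftrightarrow> A \<subset> B" if "A \<subseteq> X" "B \<subseteq> X" for A B X :: "('a \<times> 'a) set"
    using that by blast
  ultimately show ?thesis using assms by (simp add: AR_less_def)
qed

lemma AR_covers_opposite: "AR_covers D (opposite E) (opposite F) \<longleftrightarrow> AR_covers D F E"
proof -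
  have "AR_covers D (opposite E) (opposite F)" if "AR_covers D F E" for E F
    using that unfolding AR_covers_def
    by (metis AR_less_opposite opposite_opposite opposite_reorientation)
  from this[of F E] this[of "opposite E" "opposite F"] show ?thesis by auto
qed

lemma meet_irreducibles_iff: "I \<in> meet_irreducibles D \<longleftrightarrow> opposite I \<in> join_irreducibles D"
proof -
  have "(\<exists>!F. Q (opposite F)) \<longleftrightarrow> (\<exists>!E. Q E)" for Q
    by (metis opposite_opposite)
  from this[of "AR_covers D (opposite I)"]
  have "(\<exists>!F. AR_covers D F I) \<longleftrightarrow> (\<exists>!E. AR_covers D (opposite I) E)"
    by (simp add: AR_covers_opposite)
  then show ?thesis by (simp add: meet_irreducibles_def join_irreducibles_def)
qed

lemma swap_swap_rope [simp]: "swap_rope (swap_rope \<rho>) = \<rho>"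
  by (simp add: swap_rope_def split: prod.splits)

lemma swap_rope_in_ropes [simp]: "swap_rope \<rho> \<in> ropes D \<longleftrightarrow> \<rho> \<in> ropes D"
  by (auto simp: swap_rope_def ropes_def)

text \<open>The reduction of \<open>opposite I\<close> is the converse of that of \<open>I\<close>,
  so both sides select the same arc; kept and reversed arcs trade places, which swaps the sides of
  the rope.\<close>

lemma rho_meet_eq:
  assumes "I \<in> acyclic_reorientations D"
  shows "rho_meet D I = swap_rope (rho_join D (opposite I))"
proof -
  have "arcs (transitive_reduction (with_proj (opposite I))) = (cover_rel (parcs I))\<inverse>"
    using assms arcs_transitive_reduction_reorientation[of "opposite I"]
    by (simp add: cover_rel_converse) (simp add: opposite_def cover_rel_converse)
  moreover have "rope_of D I a = swap_rope (rope_of D (opposite I) a)" for a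
    using assms orientation_iff[of "parcs I"]
    by (cases a) (auto simp: rope_of_eq swap_rope_def nabla_def delta_def opposite_def acyclic_reorientations_iff)
  ultimately show ?thesis
    by (simp add: rho_meet_def rho_join_def arcs_transitive_reduction_reorientation[OF assms])
qed

text \<open>\<open>I_meet\<close> keeps exactly the arcs that \<open>I_join\<close> reverses for the
  swapped rope.\<close>

lemma I_meet_eq: "I_meet D \<rho> = opposite (I_join D (swap_rope \<rho>))"
proof -
  obtain u v N T where \<rho>: "\<rho> = (u, v, N, T)" by (cases \<rho>)
  show ?thesis
    unfolding \<rho> I_meet_def I_join_def opposite_def swap_rope_def reorient_def
    by simp (rule arg_cong[where f = "\<lambda>r. D\<lparr>parcs := r\<rparr>"], blast)
qed

end

section \<open>The inverse bijections for a filled acyclic digraph\<close>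

locale filled_dag = acyclic_digraph D for D :: "'a pair_pre_digraph" +
  assumes filled: "filled D"
begin

text \<open>Filledness gives undirected adjacency along a path; the opposite direction would close a
  cycle.\<close>

lemma filled_adjacent:
  assumes "(u, v) \<in> parcs D" "w \<in> between (parcs D) u v"
  shows "w \<noteq> u \<Longrightarrow> (u, w) \<in> parcs D" and "w \<noteq> v \<Longrightarrow> (w, v) \<in> parcs D"
proof -
  have sym: "(x, y) \<in> parcs (mk_symmetric (with_proj D)) \<longleftrightarrow> (x, y) \<in> parcs D \<or> (y, x) \<in> parcs D" for x y
    by (simp add: mk_symmetric_eq)
  obtain p where p: "apath u p v" "w \<in> set (pawalk_verts u p)"
    using assms transitive_support_eq_between[OF acyclic_arcs in_arcsD1[OF assms(1)], of v]
    by (auto simp: transitive_support_def)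
  have ends: "u \<in> set (pawalk_verts u p)" "v \<in> set (pawalk_verts u p)"
    using hd_in_awalk_verts(2)[OF p(1)] set_awalk_verts_append[of u p v "[]" v] p(1) awalk_last_in_verts[of u p v]
    by (simp_all add: apath_def awalk_Nil_iff) blast
  have adj: "x \<noteq> y \<Longrightarrow> (x, y) \<in> parcs D \<or> (y, x) \<in> parcs D"
    if "x \<in> set (pawalk_verts u p)" "y \<in> set (pawalk_verts u p)" for x y
    using filled p(1) assms(1) that unfolding filled_def sym by blast
  have path: "(u, w) \<in> (parcs D)\<^sup>*" "(w, v) \<in> (parcs D)\<^sup>*" using assms(2) by (auto simp: between_def)
  show "(u, w) \<in> parcs D" if "w \<noteq> u"
    using adj[OF ends(1) p(2)] that path(1) acyclic_antisym[OF acyclic_arcs] by blast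
  show "(w, v) \<in> parcs D" if "w \<noteq> v"
    using adj[OF p(2) ends(2)] that path(2) acyclic_antisym[OF acyclic_arcs] by blast
qed

end

sublocale filled_dag \<subseteq> filled_rel "parcs D"
  by unfold_locales (fact filled_adjacent)+

context filled_dag
begin

lemma rho_join_rope:
  assumes "I \<in> join_irreducibles D"
  shows "rho_join D I \<in> ropes D" and "I_join D (rho_join D I) = I"
proof -
  obtain u v where I: "I \<in> acyclic_reorientations D" and uv: "descents (parcs I) = {(u, v)}"
    using assms by (auto simp: join_irreducibles_iff)
  then have ori: "pverts I = pverts D" "orientation (parcs D) (parcs I)"
    by (auto simp: acyclic_reorientations_iff)
  note rho = rho_join_eq[OF I uv]
  have "(u, v) \<in> parcs D" using uv by (auto simp: descents_def)
  moreover have "nabla (parcs I) u v \<inter> delta (parcs I) u v = {}" by (auto simp: nabla_def delta_def)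
  ultimately show rope: "rho_join D I \<in> ropes D"
    using nabla_Un_delta[OF ori(2), of u v] uv by (simp add: rho ropes_iff)
  then have J: "orientation (parcs D) (parcs (I_join D (rho_join D I)))"
    using orientation_of_rope by (simp add: rho ropes_iff I_join_eq)
  \<comment> \<open>\<open>D\<close> has no opposite arcs, so the reversed set is exactly the
    flipped one, and it determines the orientation.\<close>
  have "parcs D \<inter> (parcs (I_join D (rho_join D I)))\<inverse> = flips u v (nabla (parcs I) u v) (delta (parcs I) u v)"
    using not_both by (auto simp: rho I_join_eq flips_def)
  then have "parcs (I_join D (rho_join D I)) = parcs I"
    using eq_if_reversed_eq[OF J ori(2)] reversed_iff_flips[OF ori(2) uv] by simp
  then show "I_join D (rho_join D I) = I" using ori(1) by (simp add: rho I_join_eq)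
qed

lemma I_join_irreducible:
  assumes "\<rho> \<in> ropes D"
  shows "I_join D \<rho> \<in> join_irreducibles D" and "rho_join D (I_join D \<rho>) = \<rho>"
proof -
  obtain u v N T where \<rho>: "\<rho> = (u, v, N, T)" by (cases \<rho>)
  then have rope: "(u, v) \<in> parcs D" "N \<inter> T = {}" "N \<union> T = between (parcs D) u v - {u, v}"
    using assms by (auto simp: ropes_iff)
  have I: "I_join D \<rho> \<in> acyclic_reorientations D"
    using orientation_of_rope[OF rope] by (simp add: \<rho> I_join_eq acyclic_reorientations_iff)
  moreover have desc: "descents (parcs (I_join D \<rho>)) = {(u, v)}"
    using descents_of_rope[OF rope] by (simp add: \<rho> I_join_eq)
  ultimately show "I_join D \<rho> \<in> join_irreducibles D" by (auto simp: join_irreducibles_iff)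
  show "rho_join D (I_join D \<rho>) = \<rho>"
    using rho_join_eq[OF I desc] nabla_of_rope[OF rope] delta_of_rope[OF rope] by (simp add: \<rho> I_join_eq)
qed

text \<open>The meet maps are the join maps conjugated by \<open>opposite\<close> and
  \<open>swap_rope\<close>; the involutions cancel.\<close>

lemma rho_meet_rope:
  assumes "I \<in> meet_irreducibles D"
  shows "rho_meet D I \<in> ropes D" and "I_meet D (rho_meet D I) = I"
proof -
  have I: "I \<in> acyclic_reorientations D" "opposite I \<in> join_irreducibles D"
    using assms by (auto simp: meet_irreducibles_def meet_irreducibles_iff[symmetric])
  show "rho_meet D I \<in> ropes D" "I_meet D (rho_meet D I) = I"
    using rho_join_rope[OF I(2)] by (simp_all add: rho_meet_eq[OF I(1)] I_meet_eq)
qed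

lemma I_meet_irreducible:
  assumes "\<rho> \<in> ropes D"
  shows "I_meet D \<rho> \<in> meet_irreducibles D" and "rho_meet D (I_meet D \<rho>) = \<rho>"
proof -
  have J: "I_join D (swap_rope \<rho>) \<in> join_irreducibles D"
    "rho_join D (I_join D (swap_rope \<rho>)) = swap_rope \<rho>"
    using I_join_irreducible[of "swap_rope \<rho>"] assms by simp_all
  then have "I_meet D \<rho> \<in> acyclic_reorientations D"
    by (simp add: I_meet_eq join_irreducibles_def)
  then show "I_meet D \<rho> \<in> meet_irreducibles D" "rho_meet D (I_meet D \<rho>) = \<rho>"
    using J by (simp_all add: meet_irreducibles_iff rho_meet_eq) (simp_all add: I_meet_eq)
qed

end

theorem proposition28:
  fixes D :: "'a pair_pre_digraph"
  assumes "pair_digraph D" and "acyclic (parcs D)" and "skeletal D"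
  shows "(bij_betw (rho_join D) (join_irreducibles D) (ropes D) \<and>
          bij_betw (I_join D) (ropes D) (join_irreducibles D) \<and>
          (\<forall>I \<in> join_irreducibles D. I_join D (rho_join D I) = I) \<and>
          (\<forall>\<rho> \<in> ropes D. rho_join D (I_join D \<rho>) = \<rho>)) \<and>
         (bij_betw (rho_meet D) (meet_irreducibles D) (ropes D) \<and>
          bij_betw (I_meet D) (ropes D) (meet_irreducibles D) \<and>
          (\<forall>I \<in> meet_irreducibles D. I_meet D (rho_meet D I) = I) \<and>
          (\<forall>\<rho> \<in> ropes D. rho_meet D (I_meet D \<rho>) = \<rho>))"
proof -
  interpret filled_dag D
    using assms by (simp add: filled_dag_def acyclic_digraph_def acyclic_digraph_axioms_def
        filled_dag_axioms_def skeletal_def)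
  have inverse_bij: "bij_betw f A B \<and> bij_betw g B A \<and> (\<forall>x \<in> A. g (f x) = x) \<and> (\<forall>y \<in> B. f (g y) = y)"
    if "\<And>x. x \<in> A \<Longrightarrow> f x \<in> B" "\<And>x. x \<in> A \<Longrightarrow> g (f x) = x"
      "\<And>y. y \<in> B \<Longrightarrow> g y \<in> A" "\<And>y. y \<in> B \<Longrightarrow> f (g y) = y"
    for f :: "'a pair_pre_digraph \<Rightarrow> 'a rope" and g A B
  proof -
    have "f ` A \<subseteq> B" "g ` B \<subseteq> A" using that(1,3) by auto
    then show ?thesis
      using bij_betw_byWitness[of A g f B] bij_betw_byWitness[of B f g A] that(2,4) by simp
  qed
  show ?thesis
    using inverse_bij[of "join_irreducibles D" "rho_join D" "ropes D" "I_join D",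
        OF rho_join_rope I_join_irreducible]
      inverse_bij[of "meet_irreducibles D" "rho_meet D" "ropes D" "I_meet D",
        OF rho_meet_rope I_meet_irreducible]
    by (rule conjI)
qed

end
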